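(* For every finite set $\Gamma$ of MSO formulas and all step-wMSO formulas $\Psi_1,\Psi_2$: $\Psi_1\sim_\Gamma\Psi_2$ if and only if $\Gamma\vdash\Psi_1\approx\Psi_2$ in the step-wMSO proof system.
   Context: MSO formulas over a finite alphabet $\Sigma$: $\varphi ::= \top \mid P_a(x)\mid x\le y\mid x\in X\mid \neg\varphi\mid \varphi\wedge\varphi\mid \forall x.\varphi\mid\forall X.\varphi$, interpreted over pairs $(w,\sigma)$ with $w\in\Sigma^+$ and $\sigma$ a valuation (first-order variables to positions, second-order variables to sets of positions). step-wMSO over a weight set $R$: $\Psi::= r\mid\varphi\,?\,\Psi_1:\Psi_2$, with $[\![r]\!](w,\sigma)=r$, $[\![\varphi\,?\,\Psi_1:\Psi_2]\!](w,\sigma)=[\![\Psi_1]\!](w,\sigma)$ if $(w,\sigma)\models\varphi$ and $[\![\Psi_2]\!](w,\sigma)$ otherwise. $[\![\Gamma]\!]$ is the set of pairs satisfying all formulas of $\Gamma$; $\Psi_1\sim_\Gamma\Psi_2$ means equal semantics on all of $[\![\Gamma]\!]$. $\Gamma\vdash\varphi$ for MSO formulas refers to a fixed sound and complete proof system for MSO over finite nonempty words (for finite $\Gamma$, $\Gamma\vdash\varphi$ iff $\Gamma\models\varphi$). The step-wMSO proof system derives $\Gamma\vdash\Psi_1\approx\Psi_2$ by: (ref) $\Gamma\vdash\Psi\approx\Psi$; (sym) $\Gamma\vdash\Psi_1\approx\Psi_2\Rightarrow\Gamma\vdash\Psi_2\approx\Psi_1$; (trans) $\Gamma\vdash\Psi_1\approx\Psi_2$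 and $\Gamma\vdash\Psi_2\approx\Psi_3\Rightarrow\Gamma\vdash\Psi_1\approx\Psi_3$; (cong?) $\Gamma\vdash\Psi_1\approx\Psi_1'$ and $\Gamma\vdash\Psi_2\approx\Psi_2'\Rightarrow\Gamma\vdash\varphi\,?\,\Psi_1:\Psi_2\approx\varphi\,?\,\Psi_1':\Psi_2'$; (S1) $\Gamma\vdash\Psi_1\approx\Psi_2\Rightarrow\Gamma\cup\{\varphi\}\vdash\Psi_1\approx\Psi_2$; (S2) $\Gamma\vdash\neg\varphi\,?\,\Psi_1:\Psi_2\approx\varphi\,?\,\Psi_2:\Psi_1$; (S3) $\Gamma\vdash\varphi\Rightarrow\Gamma\vdash\varphi\,?\,\Psi_1:\Psi_2\approx\Psi_1$; (S4) $\Gamma\cup\{\varphi\}\vdash\Psi_1\approx\Psi$ and $\Gamma\cup\{\neg\varphi\}\vdash\Psi_2\approx\Psi\Rightarrow\Gamma\vdash\varphi\,?\,\Psi_1:\Psi_2\approx\Psi$. *)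

theory Defs
  imports Main
begin

text \<open>
  First-order and second-order variables are two separate sorts, both named by natural numbers.
  A word is a nonempty list; its positions are \<open>0, \<dots>, length w - 1\<close>.
\<close>

datatype 'a mso =
    Top
  | Label 'a nat
  | Leq nat nat
  | Mem nat nat
  | Neg "'a mso"
  | Conj "'a mso" "'a mso"
  | Forall1 nat "'a mso"
  | Forall2 nat "'a mso"

type_synonym valuation = "(nat \<Rightarrow> nat) \<times> (nat \<Rightarrow> nat set)"

definition positions :: "'a list \<Rightarrow> nat set" where
  "positions w = {..<length w}"

definition is_valuation :: "'a list \<Rightarrow> valuation \<Rightarrow> bool" where
  "is_valuation w \<sigma> \<longleftrightarrow>
     (\<forall>x. fst \<sigma> x \<in> positions w) \<and> (\<forall>X. snd \<sigma> X \<subseteq> positions w)"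

primrec sat :: "'a list \<Rightarrow> valuation \<Rightarrow> 'a mso \<Rightarrow> bool" where
  "sat w \<sigma> Top \<longleftrightarrow> True"
| "sat w \<sigma> (Label a x) \<longleftrightarrow> w ! fst \<sigma> x = a"
| "sat w \<sigma> (Leq x y) \<longleftrightarrow> fst \<sigma> x \<le> fst \<sigma> y"
| "sat w \<sigma> (Mem x X) \<longleftrightarrow> fst \<sigma> x \<in> snd \<sigma> X"
| "sat w \<sigma> (Neg \<phi>) \<longleftrightarrow> \<not> sat w \<sigma> \<phi>"
| "sat w \<sigma> (Conj \<phi> \<psi>) \<longleftrightarrow> sat w \<sigma> \<phi> \<and> sat w \<sigma> \<psi>"
| "sat w \<sigma> (Forall1 x \<phi>) \<longleftrightarrow> (\<forall>i \<in> positions w. sat w ((fst \<sigma>)(x := i), snd \<sigma>) \<phi>)"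
| "sat w \<sigma> (Forall2 X \<phi>) \<longleftrightarrow> (\<forall>I \<subseteq> positions w. sat w (fst \<sigma>, (snd \<sigma>)(X := I)) \<phi>)"

definition models :: "'a mso set \<Rightarrow> ('a list \<times> valuation) set" where
  "models \<Gamma> = {(w, \<sigma>). w \<noteq> [] \<and> is_valuation w \<sigma> \<and> (\<forall>\<phi> \<in> \<Gamma>. sat w \<sigma> \<phi>)}"

definition entails :: "'a mso set \<Rightarrow> 'a mso \<Rightarrow> bool" where
  "entails \<Gamma> \<phi> \<longleftrightarrow> (\<forall>(w, \<sigma>) \<in> models \<Gamma>. sat w \<sigma> \<phi>)"

text \<open>
  No particular calculus for MSO is fixed: its derivability relation is a parameter
  \<open>prv\<close>, of which only soundness and completeness for finite sets of premises is required.
\<close>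

definition sound_complete :: "('a mso set \<Rightarrow> 'a mso \<Rightarrow> bool) \<Rightarrow> bool" where
  "sound_complete prv \<longleftrightarrow> (\<forall>\<Gamma> \<phi>. finite \<Gamma> \<longrightarrow> (prv \<Gamma> \<phi> \<longleftrightarrow> entails \<Gamma> \<phi>))"

text \<open>\<open>Cond \<phi> \<Psi>1 \<Psi>2\<close> is the conditional \<open>\<phi> ? \<Psi>1 : \<Psi>2\<close>; the weight set is the type \<open>'r\<close>.\<close>

datatype ('a, 'r) step =
    Weight 'r
  | Cond "'a mso" "('a, 'r) step" "('a, 'r) step"

primrec sem :: "('a, 'r) step \<Rightarrow> 'a list \<Rightarrow> valuation \<Rightarrow> 'r" where
  "sem (Weight r) w \<sigma> = r"
| "sem (Cond \<phi> \<Psi>1 \<Psi>2) w \<sigma> = (if sat w \<sigma> \<phi> then sem \<Psi>1 w \<sigma> else sem \<Psi>2 w \<sigma>)"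

definition step_equiv :: "'a mso set \<Rightarrow> ('a, 'r) step \<Rightarrow> ('a, 'r) step \<Rightarrow> bool" where
  "step_equiv \<Gamma> \<Psi>1 \<Psi>2 \<longleftrightarrow> (\<forall>(w, \<sigma>) \<in> models \<Gamma>. sem \<Psi>1 w \<sigma> = sem \<Psi>2 w \<sigma>)"

inductive step_prv ::
  "('a mso set \<Rightarrow> 'a mso \<Rightarrow> bool) \<Rightarrow> 'a mso set \<Rightarrow> ('a, 'r) step \<Rightarrow> ('a, 'r) step \<Rightarrow> bool"
  for prv where
  ref: "step_prv prv \<Gamma> \<Psi> \<Psi>"
| sym: "step_prv prv \<Gamma> \<Psi>1 \<Psi>2 \<Longrightarrow> step_prv prv \<Gamma> \<Psi>2 \<Psi>1"
| trans: "step_prv prv \<Gamma> \<Psi>1 \<Psi>2 \<Longrightarrow> step_prv prv \<Gamma> \<Psi>2 \<Psi>3 \<Longrightarrow> step_prv prv \<Gamma> \<Psi>1 \<Psi>3"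
| cong: "step_prv prv \<Gamma> \<Psi>1 \<Psi>1' \<Longrightarrow> step_prv prv \<Gamma> \<Psi>2 \<Psi>2' \<Longrightarrow>
    step_prv prv \<Gamma> (Cond \<phi> \<Psi>1 \<Psi>2) (Cond \<phi> \<Psi>1' \<Psi>2')"
| S1: "step_prv prv \<Gamma> \<Psi>1 \<Psi>2 \<Longrightarrow> step_prv prv (\<Gamma> \<union> {\<phi>}) \<Psi>1 \<Psi>2"
| S2: "step_prv prv \<Gamma> (Cond (Neg \<phi>) \<Psi>1 \<Psi>2) (Cond \<phi> \<Psi>2 \<Psi>1)"
| S3: "prv \<Gamma> \<phi> \<Longrightarrow> step_prv prv \<Gamma> (Cond \<phi> \<Psi>1 \<Psi>2) \<Psi>1"
| S4: "step_prv prv (\<Gamma> \<union> {\<phi>}) \<Psi>1 \<Psi> \<Longrightarrow> step_prv prv (\<Gamma> \<union> {Neg \<phi>}) \<Psi>2 \<Psi> \<Longrightarrow>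
    step_prv prv \<Gamma> (Cond \<phi> \<Psi>1 \<Psi>2) \<Psi>"

end

theory Submission
  imports Defs
begin

text \<open>
  Completeness: rule S4 and symmetry remove the conditionals on either side, moving their guards
  into \<open>\<Gamma>\<close>, until two weights are left to compare. If these differ, then \<open>\<Gamma>\<close> has no model and
  hence derives both \<open>\<phi>\<close> and \<open>\<not> \<phi>\<close>, so that by S2 and S3 the term \<open>\<not> \<phi> ? \<Psi>1 : \<Psi>2\<close> is provably
  equal to both of its branches.
\<close>

text \<open>The guard splits the models of \<Gamma> into two disjoint classes. Read from right to
  left this is the soundness of S4; from left to right it makes S4 invertible, which drives
  completeness.\<close>

lemma step_equiv_Cond_iff:
  "step_equiv \<Gamma> (Cond \<phi> \<Psi>1 \<Psi>2) \<Psi> \<longleftrightarrow>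
    step_equiv (\<Gamma> \<union> {\<phi>}) \<Psi>1 \<Psi> \<and> step_equiv (\<Gamma> \<union> {Neg \<phi>}) \<Psi>2 \<Psi>"
  unfolding step_equiv_def models_def by auto

lemma step_equiv_sym: "step_equiv \<Gamma> \<Psi>1 \<Psi>2 \<Longrightarrow> step_equiv \<Gamma> \<Psi>2 \<Psi>1"
  unfolding step_equiv_def by auto

lemma step_prv_sound:
  assumes "sound_complete prv" "step_prv prv \<Gamma> \<Psi>1 \<Psi>2" "finite \<Gamma>"
  shows "step_equiv \<Gamma> \<Psi>1 \<Psi>2"
  using assms(2,3)
proof (induction rule: step_prv.induct)
  \<comment> \<open>Only here is \<open>prv\<close> consulted, and its soundness is limited to
    finite premise sets; hence finiteness of \<Gamma> is carried through the induction.\<close>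
  case (S3 \<Gamma> \<phi> \<Psi>1 \<Psi>2)
  then have "entails \<Gamma> \<phi>"
    using assms(1) by (simp add: sound_complete_def)
  then show ?case
    by (auto simp: entails_def step_equiv_def)
next
  case (S4 \<Gamma> \<phi> \<Psi>1 \<Psi> \<Psi>2)
  then show ?case
    by (simp add: step_equiv_Cond_iff)
qed (auto simp: step_equiv_def models_def)

lemma step_prv_if_inconsistent:
  assumes "prv \<Gamma> \<phi>" "prv \<Gamma> (Neg \<phi>)"
  shows "step_prv prv \<Gamma> \<Psi>1 \<Psi>2"
proof -
  have "step_prv prv \<Gamma> \<Psi>1 (Cond (Neg \<phi>) \<Psi>1 \<Psi>2)"
    using assms(2) by (intro step_prv.sym[OF step_prv.S3])
  moreover have "step_prv prv \<Gamma> (Cond (Neg \<phi>) \<Psi>1 \<Psi>2) \<Psi>2"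
    using step_prv.S2 step_prv.S3[of prv, OF assms(1)] by (rule step_prv.trans)
  ultimately show ?thesis
    by (rule step_prv.trans)
qed

text \<open>S4 analyses only the left-hand term, so the right-hand one is first taken to be a
  weight. \<Gamma> varies in the induction because each S4 step adds a guard.\<close>

lemma step_prv_complete_Weight:
  assumes "sound_complete prv" "finite \<Gamma>" "step_equiv \<Gamma> \<Psi> (Weight r)"
  shows "step_prv prv \<Gamma> \<Psi> (Weight r)"
  using assms(2,3)
proof (induction \<Psi> arbitrary: \<Gamma>)
  case (Weight s)
  show ?case
  proof (cases "s = r")
    case True
    then show ?thesis
      by (simp add: step_prv.ref)
  next
    case False
    then have "models \<Gamma> = {}"
      using Weight.prems(2) by (auto simp: step_equiv_def)
    then have "prv \<Gamma> \<phi>" for \<phi>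
      using assms(1) Weight.prems(1) by (simp add: sound_complete_def entails_def)
    then show ?thesis
      by (blast intro: step_prv_if_inconsistent)
  qed
next
  case (Cond \<phi> \<Psi>1 \<Psi>2)
  then show ?case
    by (intro step_prv.S4) (simp_all add: step_equiv_Cond_iff)
qed

lemma step_prv_complete:
  assumes "sound_complete prv" "finite \<Gamma>" "step_equiv \<Gamma> \<Psi>1 \<Psi>2"
  shows "step_prv prv \<Gamma> \<Psi>1 \<Psi>2"
  using assms(2,3)
proof (induction \<Psi>1 arbitrary: \<Gamma>)
  \<comment> \<open>With the left side reduced to a weight, symmetry lets the previous lemma take
    \<open>\<Psi>2\<close> apart.\<close>
  case (Weight r)
  then show ?case
    using assms(1) by (blast intro: step_prv.sym step_prv_complete_Weight step_equiv_sym)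
next
  case (Cond \<phi> \<Psi>1 \<Psi>1')
  then show ?case
    by (intro step_prv.S4) (simp_all add: step_equiv_Cond_iff)
qed

theorem theorem3:
  fixes prv :: "'a::finite mso set \<Rightarrow> 'a mso \<Rightarrow> bool"
    and \<Gamma> :: "'a mso set"
    and \<Psi>1 \<Psi>2 :: "('a, 'r) step"
  assumes "sound_complete prv"
    and "finite \<Gamma>"
  shows "step_equiv \<Gamma> \<Psi>1 \<Psi>2 \<longleftrightarrow> step_prv prv \<Gamma> \<Psi>1 \<Psi>2"
  using assms step_prv_sound step_prv_complete by blast

end
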